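(* Let $A\in\mathcal{M}_{m\times n}(\mathbb{N})$ be a matrix with non-zero columns, let $I_A$ be the toric ideal of $A$ in $R=\mathbb{K}[e_1,\dots,e_n]$, and let $\boldsymbol{m}=e_1\cdots e_n$. Then $$\left(I_A^{2}:\boldsymbol{m}^{\infty}\right)=I_A^{(2)}.$$
   Context: $\mathbb{K}$ is an algebraically closed field of characteristic zero, and $\mathbb{N}$ includes $0$. Let $A\in\mathcal{M}_{m\times n}(\mathbb{N})$ have columns $\varsigma_1,\dots,\varsigma_n\in\mathbb{N}^m$, all non-zero. The map $\varphi_A:\mathbb{K}[e_1,\dots,e_n]\to\mathbb{K}[x_1,\dots,x_m]$ is the $\mathbb{K}$-algebra homomorphism with $\varphi_A(e_i)=x^{\varsigma_i}$, and the toric ideal of $A$ is $I_A=\ker(\varphi_A)$, a prime ideal. The $k$-th symbolic power of the prime ideal $I_A$ is $I_A^{(k)}=I_A^kR_{I_A}\cap R=\{f\in R\mid fg\in I_A^k\text{ for some }g\notin I_A\}$. For an ideal $J\subseteq R$, $J:\boldsymbol{m}^\infty=\{f\in R\mid f\boldsymbol{m}^a\in J\text{ for some integer }a\ge0\}$. *)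

theory Defs
  imports
    "HOL-Analysis.Finite_Cartesian_Product"
    "HOL-Library.Poly_Mapping"
    "HOL-Computational_Algebra.Polynomial"
begin

text \<open>
  The polynomial ring in variables indexed by a finite type \<open>'v\<close> over \<open>'k\<close>: a polynomial maps each
  exponent vector (of type \<open>'v \<Rightarrow>\<^sub>0 nat\<close>) to its coefficient, all but finitely many of them zero,
  and multiplication is convolution.
\<close>

type_synonym ('v, 'k) mpoly = "('v \<Rightarrow>\<^sub>0 nat) \<Rightarrow>\<^sub>0 'k"

definition const :: "'k::comm_ring_1 \<Rightarrow> ('v, 'k) mpoly" where
  "const c = Poly_Mapping.single 0 c"

definition var :: "'v \<Rightarrow> ('v, 'k::comm_ring_1) mpoly" where
  "var i = Poly_Mapping.single (Poly_Mapping.single i 1) 1"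

definition monomial :: "nat ^ 'v \<Rightarrow> ('v::finite, 'k::comm_ring_1) mpoly" where
  "monomial s = (\<Prod>j\<in>UNIV. var j ^ (s $ j))"

definition subst :: "('v \<Rightarrow> ('w, 'k) mpoly) \<Rightarrow> ('v::finite, 'k::comm_ring_1) mpoly \<Rightarrow> ('w, 'k) mpoly" where
  "subst h p = (\<Sum>t\<in>Poly_Mapping.keys p.
     const (Poly_Mapping.lookup p t) * (\<Prod>i\<in>UNIV. h i ^ Poly_Mapping.lookup t i))"

text \<open>
  The lemmas \<open>subst_const\<close>, \<open>subst_var\<close>, \<open>subst_add\<close> and \<open>subst_mult\<close> below say that \<open>subst h\<close> is
  the algebra homomorphism that sends the variable \<open>i\<close> to \<open>h i\<close>.
\<close>

definition toric_hom :: "nat ^ 'n ^ 'm \<Rightarrow> ('n::finite, 'k::comm_ring_1) mpoly \<Rightarrow> ('m::finite, 'k) mpoly" where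
  "toric_hom A = subst (\<lambda>i. monomial (column i A))"

definition toric_ideal :: "nat ^ 'n ^ 'm \<Rightarrow> ('n::finite, 'k::comm_ring_1) mpoly set" where
  "toric_ideal A = {f. toric_hom A f = 0}"

text \<open>Ideals of a commutative ring are its submodules, so \<open>module.span (*)\<close> is the ideal generated
  by a set.\<close>

lemma module_times: "module ((*) :: 'r::comm_ring_1 \<Rightarrow> 'r \<Rightarrow> 'r)"
  by unfold_locales (simp_all add: algebra_simps)

definition ideal_prod :: "'r::comm_ring_1 set \<Rightarrow> 'r set \<Rightarrow> 'r set" where
  "ideal_prod I J = module.span (*) {f * g | f g. f \<in> I \<and> g \<in> J}"

primrec ideal_power :: "'r::comm_ring_1 set \<Rightarrow> nat \<Rightarrow> 'r set" where
  "ideal_power I 0 = UNIV"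
| "ideal_power I (Suc k) = ideal_prod I (ideal_power I k)"

text \<open>For a prime ideal \<open>P\<close> of a ring \<open>R\<close>, this is the contraction to \<open>R\<close> of the extension of
  \<open>P ^ k\<close> to the localization of \<open>R\<close> at \<open>P\<close>.\<close>

definition symbolic_power :: "'r::comm_ring_1 set \<Rightarrow> nat \<Rightarrow> 'r set" where
  "symbolic_power P k = {f. \<exists>g. g \<notin> P \<and> f * g \<in> ideal_power P k}"

definition saturation :: "'r::comm_ring_1 set \<Rightarrow> 'r \<Rightarrow> 'r set" where
  "saturation J x = {f. \<exists>a::nat. f * x ^ a \<in> J}"

lemma const_mult: "const (a * b) = const a * const b"
  by (simp add: const_def mult_single)

lemma const_add: "const (a + b) = const a + const b"
  by (simp add: const_def single_add)

lemma const_0 [simp]: "const 0 = 0"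
  by (simp add: const_def)

lemma const_1 [simp]: "const 1 = 1"
  by (simp add: const_def)

lemma subst_superset:
  assumes "finite S" "Poly_Mapping.keys p \<subseteq> S"
  shows "subst h p = (\<Sum>t\<in>S. const (Poly_Mapping.lookup p t) * (\<Prod>i\<in>UNIV. h i ^ Poly_Mapping.lookup t i))"
  unfolding subst_def using assms
  by (intro sum.mono_neutral_left) (auto simp: in_keys_iff)

lemma subst_single:
  "subst h (Poly_Mapping.single t c) = const c * (\<Prod>i\<in>UNIV. h i ^ Poly_Mapping.lookup t i)"
  by (subst subst_superset[of "{t}"]) auto

lemma subst_const: "subst h (const c) = const c"
  by (simp add: const_def subst_single)

lemma subst_var: "subst h (var i) = h i"
proof -
  have "(\<Prod>j\<in>UNIV. h j ^ Poly_Mapping.lookup (Poly_Mapping.single i 1) j)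
      = (\<Prod>j\<in>UNIV. if j = i then h j else 1)"
    by (intro prod.cong) (auto simp: lookup_single when_def)
  then show ?thesis
    by (simp add: var_def subst_single)
qed

lemma subst_add: "subst h (p + q) = subst h p + subst h q"
proof -
  let ?S = "Poly_Mapping.keys p \<union> Poly_Mapping.keys q"
  have "Poly_Mapping.keys (p + q) \<subseteq> ?S"
    by (rule keys_add)
  then show ?thesis
    by (simp add: subst_superset[of ?S] lookup_add const_add distrib_right sum.distrib)
qed

lemma poly_mapping_induct_single:
  assumes "P 0" "\<And>p t c. P p \<Longrightarrow> P (p + Poly_Mapping.single t c)"
  shows "P (p :: 'a \<Rightarrow>\<^sub>0 'b::ab_group_add)"
proof (induction "card (Poly_Mapping.keys p)" arbitrary: p)
  case 0
  then show ?case using assms(1) by simp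
next
  case (Suc n)
  then obtain t where t: "t \<in> Poly_Mapping.keys p"
    by (metis card.empty ex_in_conv nat.distinct(1))
  define q where "q = p - Poly_Mapping.single t (Poly_Mapping.lookup p t)"
  have "Poly_Mapping.keys q = Poly_Mapping.keys p - {t}"
    by (auto simp: q_def in_keys_iff lookup_minus lookup_single when_def split: if_splits)
  then have "P q"
    using Suc t by simp
  then have "P (q + Poly_Mapping.single t (Poly_Mapping.lookup p t))"
    by (rule assms(2))
  then show ?case by (simp add: q_def)
qed

lemma subst_mult: "subst h (p * q) = subst h p * subst h q"
proof -
  have 0: "subst h 0 = 0"
    by (simp add: subst_def)
  have 1: "subst h (Poly_Mapping.single s a * q) = subst h (Poly_Mapping.single s a) * subst h q" for s a
  proof (induction q rule: poly_mapping_induct_single)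
    case (2 q t b)
    have "subst h (Poly_Mapping.single s a * Poly_Mapping.single t b)
        = subst h (Poly_Mapping.single s a) * subst h (Poly_Mapping.single t b)"
      by (simp add: mult_single subst_single lookup_add power_add prod.distrib const_mult mult_ac)
    with 2 show ?case
      by (simp add: distrib_left subst_add)
  qed (simp add: 0)
  show ?thesis
    by (induction p rule: poly_mapping_induct_single) (simp_all add: 0 1 distrib_right subst_add)
qed

end

theory Submission
  imports Defs
begin

text \<open>
  Write \<open>I\<close> for the toric ideal, \<open>m\<close> for the product of the variables and \<open>J\<close> for the saturation of
  \<open>I\<^sup>2\<close> by \<open>m\<close>. Powers of \<open>m\<close> map to monomials, so they lie outside \<open>I\<close>, which gives
  \<open>J \<subseteq> I\<^sup>(\<^sup>2\<^sup>)\<close>. The other inclusion says that \<open>I\<^sup>2\<close> becomes \<open>I\<close>-primary once the variables are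
  inverted. Over the Laurent polynomials this holds because \<open>I/I\<^sup>2\<close> is a free module over
  the quotient by \<open>I\<close>, with one basis element \<open>e\<^sup>b - 1\<close> for each \<open>b\<close> in a basis of the lattice
  \<open>L = ker A\<close>. The proof below extracts from this picture what is needed,
  without Laurent polynomials and without a basis of \<open>L\<close>.

  Let \<open>f g \<in> I\<^sup>2\<close> with \<open>g \<notin> I\<close>. As \<open>I\<close> is prime (\<open>toric_ideal_prime\<close>), \<open>f \<in> I\<close>; applying the
  derivation \<open>D\<^sub>i = e\<^sub>i \<partial>/\<partial>e\<^sub>i\<close> to \<open>f g\<close> then yields \<open>D\<^sub>i f \<in> I\<close> too (\<open>log_deriv_symbolic_square\<close>). Both
  conditions can be read off from the coefficients: on each set of exponents \<open>t\<close> with the same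
  image \<open>d = A t\<close>, the coefficients \<open>c\<^sub>t\<close> of \<open>f\<close> satisfy \<open>\<Sum> c\<^sub>t = 0\<close> and \<open>\<Sum> c\<^sub>t t = 0\<close>.

  For \<open>u, v \<in> L\<close> the identity \<open>e\<^sup>u\<^sup>+\<^sup>v - e\<^sup>u - e\<^sup>v + 1 = (e\<^sup>u - 1) (e\<^sup>v - 1)\<close> says that \<open>u \<mapsto> e\<^sup>u - 1\<close> is
  additive modulo \<open>I\<^sup>2\<close>. Multiplying by \<open>m\<^sup>N\<close> clears the denominators: \<open>u \<mapsto> m\<^sup>N (e\<^sup>u - 1)\<close> takes
  polynomial values and is additive modulo \<open>J\<close>, for any given vectors as soon as \<open>N\<close> is large
  (\<open>conormal_additive\<close>). An additive map into a vector space over a field of characteristic zero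
  preserves linear relations with coefficients in that field
  (\<open>additive_map_preserves_relations\<close>). For a fixed \<open>t\<^sub>0\<close> of image \<open>d\<close>, applying this to the relation
  \<open>\<Sum> c\<^sub>t (t - t\<^sub>0) = 0\<close> shows that a monomial multiple of the part of \<open>f\<close> of degree \<open>d\<close> lies in \<open>J\<close>,
  and \<open>J\<close> is saturated (\<open>homogeneous_in_saturation\<close>).
\<close>

section \<open>Substituting monomials for the variables\<close>

definition expo :: "('n::finite \<Rightarrow> nat) \<Rightarrow> 'n \<Rightarrow>\<^sub>0 nat" where
  "expo g = (\<Sum>j\<in>UNIV. Poly_Mapping.single j (g j))"

lemma lookup_expo [simp]: "Poly_Mapping.lookup (expo g) i = g i"
  by (simp add: expo_def lookup_sum lookup_single when_def)

lemma sum_single_lookup: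
  assumes "finite S" "Poly_Mapping.keys p \<subseteq> S"
  shows "(\<Sum>t\<in>S. Poly_Mapping.single t (Poly_Mapping.lookup p t)) = p"
proof (rule poly_mapping_eqI)
  fix k
  have "(\<Sum>t\<in>S. Poly_Mapping.lookup p t when t = k) = Poly_Mapping.lookup p k"
    using assms by (cases "k \<in> S") (auto simp: when_def in_keys_iff)
  then show "Poly_Mapping.lookup (\<Sum>t\<in>S. Poly_Mapping.single t (Poly_Mapping.lookup p t)) k
      = Poly_Mapping.lookup p k"
    by (simp add: lookup_sum lookup_single)
qed

lemma prod_single:
  "(\<Prod>i\<in>S. Poly_Mapping.single (h i) (1::'k::comm_ring_1)) = Poly_Mapping.single (\<Sum>i\<in>S. h i) 1"
  by (induction S rule: infinite_finite_induct) (simp_all add: mult_single)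

lemma lookup_map_times:
  "Poly_Mapping.lookup (Poly_Mapping.map ((*) (n::nat)) a) k = n * Poly_Mapping.lookup a k"
  by (simp add: Poly_Mapping.map.rep_eq when_def)

lemma single_power:
  "Poly_Mapping.single (a :: 'v \<Rightarrow>\<^sub>0 nat) (1::'k::comm_ring_1) ^ n
    = Poly_Mapping.single (Poly_Mapping.map ((*) n) a) 1"
proof (induction n)
  case 0
  have "Poly_Mapping.map ((*) 0) a = 0"
    by (rule poly_mapping_eqI) (simp add: lookup_map_times)
  then show ?case by (simp only: power_0 single_one)
next
  case (Suc n)
  have "a + Poly_Mapping.map ((*) n) a = Poly_Mapping.map ((*) (Suc n)) a"
    by (rule poly_mapping_eqI) (simp add: lookup_map_times lookup_add)
  with Suc show ?case by (simp add: mult_single del: mult_Suc)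
qed

text \<open>The exponent of the image of \<open>e\<^sup>t\<close> when the variable \<open>i\<close> is sent to the monomial with exponent \<open>a i\<close>.\<close>

definition expo_image :: "('v::finite \<Rightarrow> 'w \<Rightarrow>\<^sub>0 nat) \<Rightarrow> ('v \<Rightarrow>\<^sub>0 nat) \<Rightarrow> 'w \<Rightarrow>\<^sub>0 nat" where
  "expo_image a t = (\<Sum>i\<in>UNIV. Poly_Mapping.map ((*) (Poly_Mapping.lookup t i)) (a i))"

lemma lookup_expo_image:
  "Poly_Mapping.lookup (expo_image a t) k
    = (\<Sum>i\<in>UNIV. Poly_Mapping.lookup t i * Poly_Mapping.lookup (a i) k)"
  by (simp add: expo_image_def lookup_sum lookup_map_times)

lemma subst_monomials_single:
  "subst (\<lambda>i. Poly_Mapping.single (a i) 1) (Poly_Mapping.single t c)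
    = Poly_Mapping.single (expo_image a t) c"
  by (simp add: subst_single single_power prod_single const_def mult_single expo_image_def)

lemma lookup_subst_monomials:
  assumes "finite S" "Poly_Mapping.keys p \<subseteq> S"
  shows "Poly_Mapping.lookup (subst (\<lambda>i. Poly_Mapping.single (a i) 1) p) d
    = (\<Sum>t | t \<in> S \<and> expo_image a t = d. Poly_Mapping.lookup p t)"
proof -
  have "subst (\<lambda>i. Poly_Mapping.single (a i) 1) p
      = (\<Sum>t\<in>S. Poly_Mapping.single (expo_image a t) (Poly_Mapping.lookup p t))"
    by (simp add: subst_superset[OF assms] single_power prod_single const_def mult_single expo_image_def)
  then have "Poly_Mapping.lookup (subst (\<lambda>i. Poly_Mapping.single (a i) 1) p) d
      = (\<Sum>t\<in>S. if expo_image a t = d then Poly_Mapping.lookup p t else 0)"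
    by (simp add: lookup_sum lookup_single when_def)
  also have "\<dots> = (\<Sum>t | t \<in> S \<and> expo_image a t = d. Poly_Mapping.lookup p t)"
    using assms(1) by (simp add: sum.inter_filter)
  finally show ?thesis .
qed

text \<open>A linear order on the variables makes leading terms multiplicative, so there are no zero divisors
  among polynomials in variables indexed by \<open>nat\<close>. Numbering the finitely many variables
  transfers this, since an injective renaming only relabels the coefficients.\<close>

lemma mpoly_no_zero_divisors:
  fixes f g :: "('m::finite, 'k::idom) mpoly"
  assumes "f * g = 0"
  shows "f = 0 \<or> g = 0"
proof -
  obtain \<kappa> :: "'m \<Rightarrow> nat" where \<kappa>: "inj \<kappa>"
    using finite_imp_inj_to_nat_seg[of "UNIV :: 'm set"] by auto
  define a where "a = (\<lambda>j. Poly_Mapping.single (\<kappa> j) (1::nat))"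
  define H :: "('m, 'k) mpoly \<Rightarrow> (nat, 'k) mpoly"
    where "H = subst (\<lambda>j. Poly_Mapping.single (a j) 1)"
  have image: "Poly_Mapping.lookup (expo_image a t) (\<kappa> j) = Poly_Mapping.lookup t j" for t j
  proof -
    have "Poly_Mapping.lookup (expo_image a t) (\<kappa> j)
        = (\<Sum>i\<in>UNIV. if i = j then Poly_Mapping.lookup t i else 0)"
      unfolding lookup_expo_image a_def
      by (intro sum.cong) (auto simp: lookup_single when_def inj_eq[OF \<kappa>])
    then show ?thesis by simp
  qed
  have inj: "s = t" if "expo_image a s = expo_image a t" for s t
    using that image by (metis poly_mapping_eqI)
  have zero: "p = 0" if "H p = 0" for p
  proof (rule poly_mapping_eqI)
    fix t
    let ?S = "insert t (Poly_Mapping.keys p)"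
    have "{s. s \<in> ?S \<and> expo_image a s = expo_image a t} = {t}"
      using inj by auto
    then have "Poly_Mapping.lookup (H p) (expo_image a t) = Poly_Mapping.lookup p t"
      unfolding H_def by (subst lookup_subst_monomials[of ?S]) auto
    then show "Poly_Mapping.lookup p t = Poly_Mapping.lookup 0 t"
      by (simp add: that)
  qed
  have "H f * H g = 0"
    using assms by (simp add: H_def subst_mult[symmetric]) (simp add: subst_def)
  then show ?thesis using zero by auto
qed

section \<open>The toric ideal and its grading\<close>

definition toric_degree :: "nat ^ 'n ^ 'm \<Rightarrow> ('n::finite \<Rightarrow>\<^sub>0 nat) \<Rightarrow> 'm::finite \<Rightarrow>\<^sub>0 nat" where
  "toric_degree A = expo_image (\<lambda>i. expo (($) (column i A)))"

lemma lookup_toric_degree: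
  "Poly_Mapping.lookup (toric_degree A t) j = (\<Sum>i\<in>UNIV. Poly_Mapping.lookup t i * A $ j $ i)"
  by (simp add: toric_degree_def lookup_expo_image column_def)

lemma prod_var_power:
  "(\<Prod>i\<in>UNIV. var i ^ g i) = Poly_Mapping.single (expo g) (1::'k::comm_ring_1)"
proof -
  have "Poly_Mapping.map ((*) n) (Poly_Mapping.single i 1) = Poly_Mapping.single i n" for i :: 'a and n :: nat
    by (rule poly_mapping_eqI) (auto simp: lookup_map_times lookup_single when_def)
  then show ?thesis
    by (simp add: var_def single_power prod_single expo_def)
qed

lemma toric_hom_eq:
  "toric_hom A = subst (\<lambda>i. Poly_Mapping.single (expo (($) (column i A))) 1)"
  by (simp add: toric_hom_def monomial_def prod_var_power)

lemma toric_hom_single: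
  "toric_hom A (Poly_Mapping.single t c) = Poly_Mapping.single (toric_degree A t) c"
  by (simp add: toric_hom_eq toric_degree_def subst_monomials_single)

text \<open>The set \<open>S\<close> may exceed the support of \<open>p\<close>, so that coefficients of a polynomial and of its
  derivatives can be summed over the same set.\<close>

lemma lookup_toric_hom:
  assumes "finite S" "Poly_Mapping.keys p \<subseteq> S"
  shows "Poly_Mapping.lookup (toric_hom A p) d
    = (\<Sum>t | t \<in> S \<and> toric_degree A t = d. Poly_Mapping.lookup p t)"
  using lookup_subst_monomials[OF assms] by (simp add: toric_hom_eq toric_degree_def)

lemma subspace_toric_ideal: "module.subspace (*) (toric_ideal A)"
  by (auto simp: module.subspace_def[OF module_times] toric_ideal_def toric_hom_def subst_add subst_mult)
     (simp add: subst_def)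

lemma toric_ideal_prime:
  fixes A :: "nat ^ 'n ^ 'm" and f g :: "('n, 'k::idom) mpoly"
  assumes "f * g \<in> toric_ideal A" "g \<notin> toric_ideal A"
  shows "f \<in> toric_ideal A"
  using assms mpoly_no_zero_divisors
  by (fastforce simp: toric_ideal_def toric_hom_def subst_mult)

lemma binomial_in_toric_ideal:
  assumes "toric_degree A s = toric_degree A t"
  shows "Poly_Mapping.single s (1::'k::comm_ring_1) - Poly_Mapping.single t 1 \<in> toric_ideal A"
proof -
  have minus: "Poly_Mapping.single s (1::'k) - Poly_Mapping.single t 1
      = Poly_Mapping.single s 1 + Poly_Mapping.single t (- 1)"
    by (simp add: single_uminus)
  have "toric_hom A (Poly_Mapping.single s (1::'k) - Poly_Mapping.single t 1)
      = toric_hom A (Poly_Mapping.single s 1) + toric_hom A (Poly_Mapping.single t (- 1))"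
    unfolding minus by (simp only: toric_hom_def subst_add)
  also have "\<dots> = 0"
    using assms by (simp add: toric_hom_single single_add[symmetric])
  finally show ?thesis by (simp add: toric_ideal_def)
qed

section \<open>Squares of ideals and saturations\<close>

lemma mult_in_ideal_power_2:
  assumes "a \<in> I" "b \<in> I"
  shows "a * b \<in> ideal_power I 2"
proof -
  have "b * 1 \<in> ideal_prod I UNIV"
    unfolding ideal_prod_def using assms by (intro module.span_base[OF module_times]) blast
  then show ?thesis
    using assms unfolding numeral_2_eq_2 ideal_power.simps ideal_prod_def
    by (intro module.span_base[OF module_times]) auto
qed

lemma subspace_ideal_power_2: "module.subspace (*) (ideal_power I 2)"
  by (simp add: numeral_2_eq_2 ideal_prod_def module.subspace_span[OF module_times])

lemma ideal_power_2_subset: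
  assumes Q: "module.subspace (*) Q" and mult: "\<And>a b. a \<in> I \<Longrightarrow> b \<in> I \<Longrightarrow> a * b \<in> Q"
  shows "ideal_power I 2 \<subseteq> Q"
proof -
  note sub = module.subspace_def[OF module_times]
  have "module.subspace (*) {h. \<forall>f\<in>I. f * h \<in> Q}"
    using Q by (simp add: sub distrib_left mult.left_commute)
  moreover have "{g * k | g k. g \<in> I \<and> k \<in> UNIV} \<subseteq> {h. \<forall>f\<in>I. f * h \<in> Q}"
  proof (clarsimp)
    fix g k f assume "g \<in> I" "f \<in> I"
    then have "k * (f * g) \<in> Q"
      using Q mult by (simp add: sub)
    then show "f * (g * k) \<in> Q" by (simp add: mult_ac)
  qed
  ultimately have "ideal_prod I UNIV \<subseteq> {h. \<forall>f\<in>I. f * h \<in> Q}"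
    unfolding ideal_prod_def by (intro module.span_minimal[OF module_times])
  then show ?thesis
    unfolding numeral_2_eq_2 ideal_power.simps
    by (subst ideal_prod_def) (intro module.span_minimal[OF module_times _ Q], blast)
qed

lemma subspace_saturation:
  assumes J: "module.subspace (*) J"
  shows "module.subspace (*) (saturation J x)"
proof -
  note sub = module.subspace_def[OF module_times]
  have "f + g \<in> saturation J x" if fg: "f \<in> saturation J x" "g \<in> saturation J x" for f g
  proof -
    obtain a b where "f * x ^ a \<in> J" "g * x ^ b \<in> J"
      using fg by (auto simp: saturation_def)
    then have "x ^ b * (f * x ^ a) + x ^ a * (g * x ^ b) \<in> J"
      using J by (simp add: sub)
    then have "(f + g) * x ^ (a + b) \<in> J"
      by (simp add: algebra_simps power_add)
    then show ?thesis by (auto simp: saturation_def)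
  qed
  moreover have "c * f \<in> saturation J x" if f: "f \<in> saturation J x" for c f
  proof -
    obtain a where "f * x ^ a \<in> J"
      using f by (auto simp: saturation_def)
    then have "c * f * x ^ a \<in> J"
      using J by (simp add: sub mult.assoc)
    then show ?thesis by (auto simp: saturation_def)
  qed
  ultimately show ?thesis
    using J by (auto simp: sub) (simp add: saturation_def)
qed

lemma saturation_cancel:
  assumes "f * x ^ a \<in> saturation J x"
  shows "f \<in> saturation J x"
  using assms by (auto simp: saturation_def mult.assoc power_add[symmetric])

section \<open>Additive maps preserve linear relations\<close>

text \<open>Gaussian elimination on the family \<open>u\<close>: if \<open>p = u\<^sub>s\<^sub>,\<^sub>i \<noteq> 0\<close>, then replacing every other \<open>u\<^sub>t\<close> by
  \<open>p u\<^sub>t - u\<^sub>t\<^sub>,\<^sub>i u\<^sub>s\<close> and dropping \<open>u\<^sub>s\<close> gives a shorter family with the same coefficients and again a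
  vanishing combination, because the \<open>i\<close>-th coordinate of the relation expresses \<open>p c\<^sub>s\<close> by the other
  terms. The same computation for the images multiplies their combination by \<open>p\<close>, which is
  invertible in characteristic zero.

  The filter \<open>F\<close> allows a family of maps \<open>\<psi> N\<close>, each of which is additive only on a bounded part of
  \<open>L\<close>: the proof uses additivity for finitely many pairs of vectors, so the maps that are additive
  on all of them suffice.\<close>

lemma additive_map_preserves_relations:
  fixes scale :: "'k::field_char_0 \<Rightarrow> 'v::ab_group_add \<Rightarrow> 'v" and u :: "'t \<Rightarrow> int ^ 'n"
  assumes V: "vector_space scale" and W: "module.subspace scale W"
    and L_add: "\<And>v w. v \<in> L \<Longrightarrow> w \<in> L \<Longrightarrow> v + w \<in> L"
    and L_scale: "\<And>k v. v \<in> L \<Longrightarrow> k *s v \<in> L"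
    and add: "\<And>v w. v \<in> L \<Longrightarrow> w \<in> L \<Longrightarrow> \<forall>\<^sub>F N in F. \<psi> N (v + w) - \<psi> N v - \<psi> N w \<in> W"
    and "finite S" and "\<And>t. t \<in> S \<Longrightarrow> u t \<in> L"
    and "\<And>i. (\<Sum>t\<in>S. c t * of_int (u t $ i)) = 0"
  shows "\<forall>\<^sub>F N in F. (\<Sum>t\<in>S. scale (c t) (\<psi> N (u t))) \<in> W"
proof -
  interpret vector_space scale by (rule V)
  have L_0: "0 \<in> L" if "v \<in> L" for v
    using L_scale[OF that, of 0] by simp
  have \<psi>_0: "\<forall>\<^sub>F N in F. \<psi> N 0 \<in> W" if "v \<in> L" for v
    using add[OF L_0[OF that] L_0[OF that]]
    by eventually_elim (use subspace_neg[OF W] in force)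
  have \<psi>_scale: "\<forall>\<^sub>F N in F. \<psi> N (k *s v) - scale (of_int k) (\<psi> N v) \<in> W" if v: "v \<in> L" for k v
  proof (induction k rule: int_induct[where k = 0])
    case base
    show ?case using \<psi>_0[OF v] by simp
  next
    case (step1 k)
    have *: "(k + 1) *s v = k *s v + v"
      by (simp add: vec_eq_iff algebra_simps)
    show ?case
      using step1.IH add[OF L_scale[OF v, of k] v]
    proof (eventually_elim)
      case (elim N)
      show ?case using subspace_add[OF W elim] unfolding *
        by (simp add: scale_left_distrib algebra_simps)
    qed
  next
    case (step2 k)
    have *: "k *s v = (k - 1) *s v + v"
      by (simp add: vec_eq_iff algebra_simps)
    show ?case
      using step2.IH add[OF L_scale[OF v, of "k - 1"] v]
    proof (eventually_elim)
      case (elim N)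
      show ?case using subspace_diff[OF W elim]
        by (simp add: * scale_left_diff_distrib algebra_simps)
    qed
  qed
  show ?thesis
    using assms(6-8)
  proof (induction "card S" arbitrary: S u)
    case 0
    then show ?case by (simp add: subspace_0[OF W])
  next
    case (Suc n)
    show ?case
    proof (cases "\<forall>t\<in>S. u t = 0")
      case True
      obtain t where t: "t \<in> S" using Suc.hyps(2) by fastforce
      from \<psi>_0[OF Suc.prems(2)[OF t]] show ?thesis
        by eventually_elim (use True in \<open>simp add: subspace_sum[OF W] subspace_scale[OF W]\<close>)
    next
      case False
      then obtain s i where s: "s \<in> S" and "u s $ i \<noteq> 0"
        by (metis vec_eq_iff zero_index)
      \<comment> \<open>The vector \<open>u s\<close> serves as pivot row, its coordinate \<open>i\<close> as pivot.\<close>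
      define p where "p = u s $ i"
      define T where "T = S - {s}"
      define u' where "u' = (\<lambda>t. p *s u t + (- (u t $ i)) *s u s)"
      have p: "p \<noteq> 0" using \<open>u s $ i \<noteq> 0\<close> by (simp add: p_def)
      have T: "finite T" "card T = n" "T \<subseteq> S"
        using Suc.hyps(2) Suc.prems(1) s by (auto simp: T_def)
      have split: "sum h S = h s + sum h T" for h :: "'t \<Rightarrow> 'b::ab_group_add"
        using Suc.prems(1) s by (simp add: T_def sum.remove)
      have uL: "u t \<in> L" if "t \<in> T" for t using Suc.prems(2) T that by auto
      have usL: "u s \<in> L" using Suc.prems(2) s .
      have rel: "(\<Sum>t\<in>T. c t * of_int (u t $ j)) = - (c s * of_int (u s $ j))" for j
        using Suc.prems(3)[of j] by (simp add: split add_eq_0_iff)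
      have "(\<Sum>t\<in>T. c t * of_int (u' t $ j)) = 0" for j
      proof -
        have "(\<Sum>t\<in>T. c t * of_int (u' t $ j))
            = of_int p * (\<Sum>t\<in>T. c t * of_int (u t $ j))
              - of_int (u s $ j) * (\<Sum>t\<in>T. c t * of_int (u t $ i))"
          by (simp add: u'_def sum_distrib_left algebra_simps sum_subtractf)
        then show ?thesis by (simp add: rel p_def)
      qed
      then have IH: "\<forall>\<^sub>F N in F. (\<Sum>t\<in>T. scale (c t) (\<psi> N (u' t))) \<in> W"
        using T uL usL by (intro Suc.hyps(1)) (auto simp: u'_def intro!: L_add L_scale)
      have "\<forall>\<^sub>F N in F. \<psi> N (u' t) - scale (of_int p) (\<psi> N (u t))
               + scale (of_int (u t $ i)) (\<psi> N (u s)) \<in> W" if t: "t \<in> T" for t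
        using add[OF L_scale[OF uL[OF t], of p] L_scale[OF usL, of "- (u t $ i)"]]
          \<psi>_scale[OF uL[OF t], of p] \<psi>_scale[OF usL, of "- (u t $ i)"]
      proof eventually_elim
        case (elim N)
        show ?case
          using subspace_add[OF W subspace_add[OF W elim(1,2)] elim(3)]
          by (simp add: u'_def algebra_simps)
      qed
      then have "\<forall>\<^sub>F N in F. \<forall>t\<in>T. \<psi> N (u' t) - scale (of_int p) (\<psi> N (u t))
               + scale (of_int (u t $ i)) (\<psi> N (u s)) \<in> W"
        using T(1) by (simp add: eventually_ball_finite_distrib)
      with IH show ?thesis
      proof eventually_elim
        case (elim N)
        let ?d = "\<lambda>t. \<psi> N (u' t) - scale (of_int p) (\<psi> N (u t)) + scale (of_int (u t $ i)) (\<psi> N (u s))"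
        have "(\<Sum>t\<in>T. scale (c t) (?d t))
            = (\<Sum>t\<in>T. scale (c t) (\<psi> N (u' t)))
              - scale (of_int p) (\<Sum>t\<in>T. scale (c t) (\<psi> N (u t)))
              + scale (\<Sum>t\<in>T. c t * of_int (u t $ i)) (\<psi> N (u s))"
          by (simp add: scale_right_distrib scale_right_diff_distrib sum.distrib sum_subtractf
              scale_sum_right scale_sum_left mult.commute)
        also have "\<dots> = (\<Sum>t\<in>T. scale (c t) (\<psi> N (u' t)))
              - scale (of_int p) (\<Sum>t\<in>S. scale (c t) (\<psi> N (u t)))"
          by (simp add: rel split p_def[symmetric] scale_right_distrib mult.commute)
        finally have "scale (of_int p) (\<Sum>t\<in>S. scale (c t) (\<psi> N (u t)))
            = (\<Sum>t\<in>T. scale (c t) (\<psi> N (u' t))) - (\<Sum>t\<in>T. scale (c t) (?d t))"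
          by simp
        also have "\<dots> \<in> W"
          using elim(2) by (intro subspace_diff[OF W elim(1)] subspace_sum[OF W] subspace_scale[OF W]) auto
        finally have "scale (inverse (of_int p)) (scale (of_int p) (\<Sum>t\<in>S. scale (c t) (\<psi> N (u t)))) \<in> W"
          by (rule subspace_scale[OF W])
        then show ?case using p by simp
      qed
    qed
  qed
qed

section \<open>Logarithmic derivations\<close>

text \<open>The derivation \<open>e\<^sub>i \<partial>/\<partial>e\<^sub>i\<close>. Unlike \<open>\<partial>/\<partial>e\<^sub>i\<close> it only rescales the coefficients, so it respects the grading
  by \<open>toric_degree\<close>.\<close>

definition log_deriv :: "'n \<Rightarrow> ('n, 'k::comm_ring_1) mpoly \<Rightarrow> ('n, 'k) mpoly" where
  "log_deriv i = Poly_Mapping.mapp (\<lambda>t c. of_nat (Poly_Mapping.lookup t i) * c)"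

lemma lookup_log_deriv:
  "Poly_Mapping.lookup (log_deriv i p) t = of_nat (Poly_Mapping.lookup t i) * Poly_Mapping.lookup p t"
  by (auto simp: log_deriv_def lookup_mapp when_def in_keys_iff)

lemma keys_log_deriv: "Poly_Mapping.keys (log_deriv i p) \<subseteq> Poly_Mapping.keys p"
  unfolding log_deriv_def by (rule keys_mapp_subset)

lemma log_deriv_0 [simp]: "log_deriv i 0 = 0"
  by (rule poly_mapping_eqI) (simp add: lookup_log_deriv)

lemma log_deriv_add: "log_deriv i (p + q) = log_deriv i p + log_deriv i q"
  by (rule poly_mapping_eqI) (simp add: lookup_log_deriv lookup_add distrib_left)

lemma log_deriv_single:
  "log_deriv i (Poly_Mapping.single t c) = Poly_Mapping.single t (of_nat (Poly_Mapping.lookup t i) * c)"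
  by (rule poly_mapping_eqI) (auto simp: lookup_log_deriv lookup_single when_def)

lemma log_deriv_mult: "log_deriv i (p * q) = log_deriv i p * q + p * log_deriv i q"
proof -
  have single: "log_deriv i (Poly_Mapping.single s a * q)
      = log_deriv i (Poly_Mapping.single s a) * q + Poly_Mapping.single s a * log_deriv i q" for s a
  proof (induction q rule: poly_mapping_induct_single)
    case (2 q t b)
    have "log_deriv i (Poly_Mapping.single s a * Poly_Mapping.single t b)
        = log_deriv i (Poly_Mapping.single s a) * Poly_Mapping.single t b
          + Poly_Mapping.single s a * log_deriv i (Poly_Mapping.single t b)"
      by (simp add: mult_single log_deriv_single lookup_add single_add[symmetric] algebra_simps)
    with 2 show ?case
      by (simp add: distrib_left log_deriv_add)
  qed simp
  show ?thesis
    by (induction p rule: poly_mapping_induct_single)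
       (simp_all add: single distrib_right log_deriv_add add_ac)
qed

text \<open>By the product rule, \<open>I\<^sup>2\<close> consists of elements whose derivatives lie in \<open>I\<close>. Differentiating
  \<open>f g \<in> I\<^sup>2\<close> and using \<open>f \<in> I\<close> leaves \<open>g D\<^sub>i f \<in> I\<close>, and \<open>I\<close> is prime.\<close>

lemma log_deriv_symbolic_square:
  fixes A :: "nat ^ 'n ^ 'm" and f :: "('n, 'k::idom) mpoly"
  assumes "f \<in> symbolic_power (toric_ideal A) 2"
  shows "f \<in> toric_ideal A" "log_deriv i f \<in> toric_ideal A"
proof -
  let ?I = "toric_ideal A :: ('n, 'k) mpoly set"
  let ?Q = "{p \<in> ?I. log_deriv i p \<in> ?I}"
  note sub = module.subspace_def[OF module_times]
  have I0: "0 \<in> ?I" and I_add: "\<And>p q. p \<in> ?I \<Longrightarrow> q \<in> ?I \<Longrightarrow> p + q \<in> ?I"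
    and I_mult: "\<And>p q. q \<in> ?I \<Longrightarrow> p * q \<in> ?I" and I_mult': "\<And>p q. p \<in> ?I \<Longrightarrow> p * q \<in> ?I"
    using subspace_toric_ideal[of A, where 'b = 'k] by (auto simp: sub) (metis mult.commute)
  have "module.subspace (*) ?Q"
    using I0 I_add I_mult by (auto simp: sub log_deriv_add log_deriv_mult)
  moreover have "a * b \<in> ?Q" if "a \<in> ?I" "b \<in> ?I" for a b
    using that I_add I_mult I_mult' by (auto simp: log_deriv_mult)
  ultimately have square: "ideal_power ?I 2 \<subseteq> ?Q"
    by (rule ideal_power_2_subset)
  obtain g where g: "g \<notin> ?I" "f * g \<in> ideal_power ?I 2"
    using assms by (auto simp: symbolic_power_def)
  then have fg: "f * g \<in> ?I" "log_deriv i (f * g) \<in> ?I"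
    using square by auto
  show f: "f \<in> ?I"
    using toric_ideal_prime fg(1) g(1) by blast
  have "log_deriv i f * g = log_deriv i (f * g) + (- log_deriv i g) * f"
    by (simp add: log_deriv_mult algebra_simps)
  then have "log_deriv i f * g \<in> ?I"
    using fg(2) f I_add I_mult by metis
  then show "log_deriv i f \<in> ?I"
    using toric_ideal_prime g(1) by blast
qed

section \<open>The conormal map of the lattice\<close>

text \<open>The exponent of \<open>m\<^sup>N e\<^sup>u\<close>. It is meaningful only when no coordinate of \<open>u\<close> is below \<open>- N\<close>;
  otherwise the conversion to \<open>nat\<close> truncates.\<close>

definition shifted :: "nat \<Rightarrow> int ^ 'n \<Rightarrow> 'n::finite \<Rightarrow>\<^sub>0 nat" where
  "shifted N u = expo (\<lambda>i. nat (int N + u $ i))"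

text \<open>The binomial \<open>m\<^sup>N (e\<^sup>u - 1)\<close>. Once \<open>m\<close> is inverted, the differences
  \<open>e\<^sup>u - 1\<close> with \<open>u\<close> in the kernel lattice generate \<open>I\<close>, and hence the conormal module \<open>I/I\<^sup>2\<close>.\<close>

definition conormal :: "nat \<Rightarrow> int ^ 'n \<Rightarrow> ('n::finite, 'k::comm_ring_1) mpoly" where
  "conormal N u = Poly_Mapping.single (shifted N u) 1 - Poly_Mapping.single (shifted N 0) 1"

definition kernel_lattice :: "nat ^ 'n ^ 'm \<Rightarrow> (int ^ 'n) set" where
  "kernel_lattice A = {u. \<forall>j. (\<Sum>i\<in>UNIV. u $ i * int (A $ j $ i)) = 0}"

lemma eventually_shift_nonneg: "\<forall>\<^sub>F N in sequentially. \<forall>i. 0 \<le> int N + (u :: int ^ 'n) $ i"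
proof (rule eventually_all_finite)
  fix i
  show "\<forall>\<^sub>F N in sequentially. 0 \<le> int N + u $ i"
    using eventually_ge_at_top[of "nat (- (u $ i))"] by eventually_elim linarith
qed

lemma prod_var_eq_power:
  "(\<Prod>i\<in>UNIV. var i) ^ N = Poly_Mapping.single (shifted N 0) (1::'k::comm_ring_1)"
  by (simp add: prod_power_distrib prod_var_power shifted_def)

lemma conormal_in_toric_ideal:
  assumes "u \<in> kernel_lattice A" "\<And>i. 0 \<le> int N + u $ i"
  shows "conormal N u \<in> toric_ideal A"
  unfolding conormal_def
proof (intro binomial_in_toric_ideal poly_mapping_eqI)
  fix j
  have "int (Poly_Mapping.lookup (toric_degree A (shifted N u)) j)
      = (\<Sum>i\<in>UNIV. u $ i * int (A $ j $ i)) + (\<Sum>i\<in>UNIV. int N * int (A $ j $ i))"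
    using assms(2) by (simp add: lookup_toric_degree shifted_def sum.distrib[symmetric] algebra_simps)
  also have "\<dots> = int (Poly_Mapping.lookup (toric_degree A (shifted N 0)) j)"
    using assms(1) by (simp add: kernel_lattice_def lookup_toric_degree shifted_def)
  finally show "Poly_Mapping.lookup (toric_degree A (shifted N u)) j
      = Poly_Mapping.lookup (toric_degree A (shifted N 0)) j"
    by simp
qed

text \<open>Multiplied by \<open>m\<^sup>N\<close>, the defect of additivity becomes \<open>conormal N u * conormal N v\<close>, a product of two
  elements of \<open>I\<close>.\<close>

lemma conormal_additive:
  fixes A :: "nat ^ 'n ^ 'm"
  assumes "u \<in> kernel_lattice A" "v \<in> kernel_lattice A"
  shows "\<forall>\<^sub>F N in sequentially. (conormal N (u + v) - conormal N u - conormal N v :: ('n, 'k::comm_ring_1) mpoly)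
    \<in> saturation (ideal_power (toric_ideal A) 2) (\<Prod>i\<in>UNIV. var i)"
  using eventually_shift_nonneg[of u] eventually_shift_nonneg[of v] eventually_shift_nonneg[of "u + v"]
proof eventually_elim
  case (elim N)
  have "shifted N (u + v) + shifted N 0 = shifted N u + shifted N v"
    using elim by (intro poly_mapping_eqI) (simp add: shifted_def lookup_add flip: of_nat_eq_iff[where 'a = int])
  then have "(conormal N (u + v) - conormal N u - conormal N v) * (\<Prod>i\<in>UNIV. var i) ^ N
      = (conormal N u * conormal N v :: ('n, 'k) mpoly)"
    by (simp add: prod_var_eq_power conormal_def algebra_simps mult_single)
  also have "\<dots> \<in> ideal_power (toric_ideal A) 2"
    using assms elim by (intro mult_in_ideal_power_2 conormal_in_toric_ideal) auto
  finally show ?case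
    by (auto simp: saturation_def)
qed

text \<open>The differences \<open>u t = t - t\<^sub>0\<close> lie in the lattice, and the two hypotheses on \<open>c\<close> combine to
  \<open>\<Sum> c t \<cdot> u t = 0\<close>. Hence \<open>\<Sum> c t m\<^sup>N (e\<^sup>t\<^sup>-\<^sup>t\<^sup>0 - 1)\<close> is in the saturation for large \<open>N\<close>. Since \<open>\<Sum> c t = 0\<close>, the
  subtracted terms cancel, and multiplication by the monomial with exponent \<open>t\<^sub>0\<close> leaves \<open>m\<^sup>N\<close> times
  the polynomial in question.\<close>

lemma homogeneous_in_saturation:
  fixes A :: "nat ^ 'n ^ 'm" and c :: "('n \<Rightarrow>\<^sub>0 nat) \<Rightarrow> 'k::field_char_0"
  assumes S: "finite S" "\<And>t. t \<in> S \<Longrightarrow> toric_degree A t = d"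
    and c: "(\<Sum>t\<in>S. c t) = 0"
    and c_expo: "\<And>i. (\<Sum>t\<in>S. of_nat (Poly_Mapping.lookup t i) * c t) = 0"
  shows "(\<Sum>t\<in>S. Poly_Mapping.single t (c t))
    \<in> saturation (ideal_power (toric_ideal A) 2) (\<Prod>i\<in>UNIV. var i)"
proof -
  let ?J = "saturation (ideal_power (toric_ideal A :: ('n, 'k) mpoly set) 2) (\<Prod>i\<in>UNIV. var i)"
  have J: "module.subspace (*) ?J"
    by (intro subspace_saturation subspace_ideal_power_2)
  note J' = J[unfolded module.subspace_def[OF module_times]]
  show ?thesis
  proof (cases "S = {}")
    case True
    then show ?thesis using J' by simp
  next
    case False
    then obtain t0 where t0: "t0 \<in> S" by blast
    define u :: "('n \<Rightarrow>\<^sub>0 nat) \<Rightarrow> int ^ 'n"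
      where "u t = (\<chi> i. int (Poly_Mapping.lookup t i) - int (Poly_Mapping.lookup t0 i))" for t
    have V: "vector_space (\<lambda>(a::'k) (p::('n, 'k) mpoly). const a * p)"
      by unfold_locales (simp_all add: algebra_simps const_add const_mult)
    have W: "module.subspace (\<lambda>(a::'k) (p::('n, 'k) mpoly). const a * p) ?J"
      using J' V by (simp add: module.subspace_def vector_space_def module_def)
    have uL: "u t \<in> kernel_lattice A" if "t \<in> S" for t
    proof -
      have "(\<Sum>i\<in>UNIV. u t $ i * int (A $ j $ i))
          = int (Poly_Mapping.lookup (toric_degree A t) j) - int (Poly_Mapping.lookup (toric_degree A t0) j)" for j
        by (simp add: u_def lookup_toric_degree algebra_simps sum_subtractf)
      then show ?thesis using S(2) that t0 by (simp add: kernel_lattice_def)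
    qed
    have "\<forall>\<^sub>F N in sequentially. (\<Sum>t\<in>S. const (c t) * (conormal N (u t) :: ('n, 'k) mpoly)) \<in> ?J"
    proof (rule additive_map_preserves_relations[OF V W, where L = "kernel_lattice A"])
      fix i
      have "(\<Sum>t\<in>S. c t * of_int (u t $ i))
          = (\<Sum>t\<in>S. of_nat (Poly_Mapping.lookup t i) * c t)
            - of_nat (Poly_Mapping.lookup t0 i) * (\<Sum>t\<in>S. c t)"
        by (simp add: u_def sum_distrib_right right_diff_distrib mult.commute sum_subtractf)
      then show "(\<Sum>t\<in>S. c t * of_int (u t $ i)) = 0"
        by (simp add: c c_expo)
    next
      fix k and v :: "int ^ 'n" assume "v \<in> kernel_lattice A"
      then show "k *s v \<in> kernel_lattice A"
        by (simp add: kernel_lattice_def mult.assoc sum_distrib_left[symmetric])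
    next
      fix v w :: "int ^ 'n" assume "v \<in> kernel_lattice A" "w \<in> kernel_lattice A"
      then show "v + w \<in> kernel_lattice A"
        by (simp add: kernel_lattice_def distrib_right sum.distrib)
    qed (fact conormal_additive S(1) uL)+
    moreover have "\<forall>\<^sub>F N in sequentially. \<forall>t\<in>S. \<forall>i. 0 \<le> int N + u t $ i"
      using S(1) by (intro eventually_ball_finite ballI eventually_shift_nonneg)
    ultimately obtain N where N: "(\<Sum>t\<in>S. const (c t) * (conormal N (u t) :: ('n, 'k) mpoly)) \<in> ?J"
        and nonneg: "\<And>t i. t \<in> S \<Longrightarrow> 0 \<le> int N + u t $ i"
      using eventually_happens'[OF sequentially_bot eventually_conj] by blast
    \<comment> \<open>Multiplication by the monomial with exponent \<open>t0\<close> undoes the translation in \<open>u\<close>.\<close>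
    have shift: "t0 + shifted N (u t) = t + shifted N 0" if "t \<in> S" for t
      using nonneg[OF that]
      by (intro poly_mapping_eqI) (simp add: shifted_def lookup_add u_def nat_eq_iff flip: of_nat_eq_iff[where 'a = int])
    have "(\<Sum>t\<in>S. const (c t)) = (const (\<Sum>t\<in>S. c t) :: ('n, 'k) mpoly)"
      by (induction S rule: infinite_finite_induct) (simp_all add: const_add)
    then have "(\<Sum>t\<in>S. const (c t) * (conormal N (u t) :: ('n, 'k) mpoly))
        = (\<Sum>t\<in>S. const (c t) * Poly_Mapping.single (shifted N (u t)) 1)"
      using c by (simp add: conormal_def right_diff_distrib sum_subtractf sum_distrib_right[symmetric])
    then have "Poly_Mapping.single t0 1 * (\<Sum>t\<in>S. const (c t) * (conormal N (u t) :: ('n, 'k) mpoly))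
        = (\<Sum>t\<in>S. Poly_Mapping.single t (c t)) * (\<Prod>i\<in>UNIV. var i) ^ N"
      by (simp add: prod_var_eq_power sum_distrib_left sum_distrib_right const_def mult_single shift)
    moreover have "Poly_Mapping.single t0 1 * (\<Sum>t\<in>S. const (c t) * (conormal N (u t) :: ('n, 'k) mpoly)) \<in> ?J"
      using N J' by blast
    ultimately have "(\<Sum>t\<in>S. Poly_Mapping.single t (c t)) * (\<Prod>i\<in>UNIV. var i) ^ N \<in> ?J"
      by (simp only:)
    then show ?thesis by (rule saturation_cancel)
  qed
qed

section \<open>The symbolic square\<close>

theorem theorem3p5:
  fixes A :: "nat ^ 'n ^ 'm"
  assumes "\<And>i. column i A \<noteq> 0"
  shows "saturation
           (ideal_power (toric_ideal A :: ('n, 'k::{alg_closed_field, field_char_0}) mpoly set) 2)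
           (\<Prod>i\<in>UNIV. var i)
         = symbolic_power (toric_ideal A) 2"
proof
  let ?I = "toric_ideal A :: ('n, 'k) mpoly set"
  let ?m = "\<Prod>i\<in>UNIV. var i :: ('n, 'k) mpoly"
  have "?m ^ a \<notin> ?I" for a
    by (simp add: prod_var_eq_power toric_ideal_def toric_hom_single)
       (metis lookup_single_eq lookup_zero zero_neq_one)
  then show "saturation (ideal_power ?I 2) ?m \<subseteq> symbolic_power ?I 2"
    by (auto simp: saturation_def symbolic_power_def)
  show "symbolic_power ?I 2 \<subseteq> saturation (ideal_power ?I 2) ?m"
  proof
    fix f assume f: "f \<in> symbolic_power ?I 2"
    let ?c = "Poly_Mapping.lookup f" and ?S = "Poly_Mapping.keys f"
    let ?fibre = "\<lambda>d. {t. t \<in> ?S \<and> toric_degree A t = d}"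
    have fibre: "(\<Sum>t\<in>?fibre d. Poly_Mapping.single t (?c t)) \<in> saturation (ideal_power ?I 2) ?m" for d
    proof (rule homogeneous_in_saturation)
      show "(\<Sum>t\<in>?fibre d. ?c t) = 0"
        using log_deriv_symbolic_square(1)[OF f] lookup_toric_hom[of ?S f A d]
        by (simp add: toric_ideal_def)
      show "(\<Sum>t\<in>?fibre d. of_nat (Poly_Mapping.lookup t i) * ?c t) = 0" for i
        using log_deriv_symbolic_square(2)[OF f, of i]
          lookup_toric_hom[OF finite_keys keys_log_deriv, of A i f d]
        by (simp add: toric_ideal_def lookup_log_deriv)
    qed auto
    have "f = (\<Sum>t\<in>?S. Poly_Mapping.single t (?c t))"
      by (simp add: sum_single_lookup)
    also have "\<dots> = (\<Sum>d\<in>toric_degree A ` ?S. \<Sum>t\<in>?fibre d. Poly_Mapping.single t (?c t))"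
      by (rule sum.image_gen) simp
    also have "\<dots> \<in> saturation (ideal_power ?I 2) ?m"
      by (rule module.subspace_sum[OF module_times
            subspace_saturation[OF subspace_ideal_power_2] fibre])
    finally show "f \<in> saturation (ideal_power ?I 2) ?m" .
  qed
qed

end
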